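(* There is a function $\varepsilon:\mathbb{Z}_{>0}\to\mathbb{R}$ with $\varepsilon(d)\to 0$ as $d\to\infty$ such that $R_f(d)\le d^{2+\varepsilon(d)}$ for all integers $d>0$. (In short, $R_f(d)\le d^{2+o(1)}$.)
   Context: For an integer $n\ge 1$, ${\overset{\leftrightarrow}{K}}_n$ denotes the complete bidirected graph on $n$ vertices: for every pair of distinct vertices $u,v$ it has both directed edges $(u,v)$ and $(v,u)$. For an integer $d>0$ and $[d]=\{1,\dots,d\}$, a $d$-labeling of ${\overset{\leftrightarrow}{K}}_n$ assigns to every directed edge $e$ a function $\ell_e:[d]\to[d]$. A cycle means a simple directed cycle. If a cycle has edges $e_1,\dots,e_k$ in this order with labels $f_1,\dots,f_k$, it is a fixed-point cycle if the map $x\mapsto f_k(f_{k-1}(\cdots f_1(x)\cdots))$ has a fixed point in $[d]$ (this does not depend on the choice of starting edge). A labeling is fixed-point-free if there is no fixed-point cycle. $R_f(d)$ is the largest $n$ such that there exists a $d$-labeling of ${\overset{\leftrightarrow}{K}}_n$ with no fixed-point cycle. *)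

theory Defs
  imports Complex_Main "HOL-Library.FuncSet" "Graph_Theory.Kuratowski"
begin

definition bidirected_K :: "nat \<Rightarrow> nat pair_pre_digraph" where
  "bidirected_K n =
     \<lparr>pverts = {1..n}, parcs = {(u, v). u \<in> {1..n} \<and> v \<in> {1..n} \<and> u \<noteq> v}\<rparr>"

definition labeling :: "nat \<Rightarrow> nat \<Rightarrow> (nat \<times> nat \<Rightarrow> nat \<Rightarrow> nat) \<Rightarrow> bool" where
  "labeling d n l \<longleftrightarrow> (\<forall>e \<in> parcs (bidirected_K n). l e \<in> {1..d} \<rightarrow> {1..d})"

text \<open>
  A cycle is given by its list of edges in order, with no repeated vertex; since there are no
  loops its length is at least two, and antiparallel pairs of edges do form cycles.
  The composition \<^term>\<open>fold l p\<close> applies the label of the first edge of \<^term>\<open>p\<close> first.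
\<close>

definition fixed_point_cycle ::
    "nat \<Rightarrow> nat \<Rightarrow> (nat \<times> nat \<Rightarrow> nat \<Rightarrow> nat) \<Rightarrow> (nat \<times> nat) list \<Rightarrow> bool" where
  "fixed_point_cycle d n l p \<longleftrightarrow>
     pre_digraph.cycle (with_proj (bidirected_K n)) p \<and> (\<exists>x \<in> {1..d}. fold l p x = x)"

definition fixed_point_free :: "nat \<Rightarrow> nat \<Rightarrow> (nat \<times> nat \<Rightarrow> nat \<Rightarrow> nat) \<Rightarrow> bool" where
  "fixed_point_free d n l \<longleftrightarrow> (\<nexists>p. fixed_point_cycle d n l p)"

definition has_fpf_labeling :: "nat \<Rightarrow> nat \<Rightarrow> bool" where
  "has_fpf_labeling d n \<longleftrightarrow> (\<exists>l. labeling d n l \<and> fixed_point_free d n l)"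

text \<open>
  That this maximum exists for \<^prop>\<open>d > 0\<close> is shown below (\<open>R_f_attained\<close>, \<open>R_f_upper\<close>).
\<close>

definition R_f :: "nat \<Rightarrow> nat" where
  "R_f d = (GREATEST n. n \<ge> 1 \<and> has_fpf_labeling d n)"


lemma complete_digraph_bidirected_K: "complete_digraph n (with_proj (bidirected_K n))"
  by (auto simp: complete_digraph_pair_def bidirected_K_def)

lemma cycle_bidirected_K_iff:
  "pre_digraph.cycle (with_proj (bidirected_K n)) p \<longleftrightarrow>
     p \<noteq> [] \<and> set p \<subseteq> parcs (bidirected_K n) \<and> pcas (fst (hd p)) p (fst (hd p)) \<and>
     distinct (map snd p)"
proof -
  have *: "tl (pawalk_verts u p) = map snd p" if "pcas u p v" for u v
    using that by (induction u p v rule: pcas.induct) (auto, case_tac es, auto)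
  have **: "u = fst (hd p)" if "pcas u p v" "p \<noteq> []" for u v
    using that by (cases p) auto
  have ***: "fst (hd p) \<in> {1..n}" if "p \<noteq> []" "set p \<subseteq> parcs (bidirected_K n)"
    using that by (cases p) (auto simp: bidirected_K_def)
  let ?u = "fst (hd p)"
  have "pre_digraph.cycle (with_proj (bidirected_K n)) p \<longleftrightarrow>
      (\<exists>u. (u \<in> {1..n} \<and> set p \<subseteq> parcs (bidirected_K n) \<and> pcas u p u) \<and>
        distinct (tl (pawalk_verts u p)) \<and> p \<noteq> [])"
    unfolding pre_digraph.cycle_def pre_digraph.awalk_def cas_with_proj_eq
      awalk_verts_with_proj_eq with_proj_simps by (simp add: bidirected_K_def)
  also have "\<dots> \<longleftrightarrow> p \<noteq> [] \<and> set p \<subseteq> parcs (bidirected_K n) \<and> pcas ?u p ?u \<and> distinct (map snd p)"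
    (is "?A \<longleftrightarrow> ?B")
  proof
    assume ?A
    then obtain u where u: "set p \<subseteq> parcs (bidirected_K n)" "pcas u p u"
      "distinct (tl (pawalk_verts u p))" "p \<noteq> []" by blast
    with **[OF u(2,4)] *[OF u(2)] show ?B by simp
  next
    assume B: ?B
    then have "?u \<in> {1..n}" "tl (pawalk_verts ?u p) = map snd p" using * *** by blast+
    with B show ?A by (intro exI[of _ ?u]) simp
  qed
  finally show ?thesis .
qed

lemma has_fpf_labeling_1: "has_fpf_labeling d 1"
proof -
  have "parcs (bidirected_K 1) = {}" by (auto simp: bidirected_K_def)
  then show ?thesis
    by (auto simp: has_fpf_labeling_def labeling_def fixed_point_free_def fixed_point_cycle_def
        cycle_bidirected_K_iff)
qed

lemma fold_concat_upt:
  assumes "i \<le> k" "\<And>t. t \<in> {i..<k} \<Longrightarrow> fold l (g t) (x t) = x (Suc t)"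
  shows "fold l (concat (map g [i..<k])) (x i) = x k"
  using assms by (induction k rule: dec_induct) auto

lemma pcas_append: "pcas u p v \<Longrightarrow> pcas v q w \<Longrightarrow> pcas u (p @ q) w"
  by (induction u p v rule: pcas.induct) auto

lemma pcas_concat_upt:
  assumes "i \<le> k" "\<And>t. t \<in> {i..<k} \<Longrightarrow> pcas (y t) (g t) (y (Suc t))"
  shows "pcas (y i) (concat (map g [i..<k])) (y k)"
  using assms by (induction k rule: dec_induct) (auto intro: pcas_append)

lemma distinct_concat_pairs:
  assumes "distinct xs" "inj_on a (set xs)" "inj_on c (set xs)" "a ` set xs \<inter> c ` set xs = {}"
  shows "distinct (concat (map (\<lambda>t. [a t, c t]) xs))"
  using assms by (induction xs) (auto simp: inj_on_def)

lemma has_fpf_labeling_bounded: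
  assumes "d > 0"
  shows "\<exists>N. \<forall>n. has_fpf_labeling d n \<longrightarrow> n \<le> N"
proof -
  define F where "F = ({1..d} \<rightarrow>\<^sub>E {1..d})"
  define S where "S = ({1..d} \<rightarrow>\<^sub>E F \<times> F)"
  have finS: "finite S"
    unfolding S_def F_def by (intro finite_PiE finite_cartesian_product) auto
  have "n \<le> d + card S * d" if hn: "has_fpf_labeling d n" for n
  proof (rule ccontr)
    assume large: "\<not> n \<le> d + card S * d"
    obtain l where lab: "labeling d n l" and free: "fixed_point_free d n l"
      using hn by (auto simp: has_fpf_labeling_def)
    have l: "l (u, v) x \<in> {1..d}"
      if "u \<in> {1..n}" "v \<in> {1..n}" "u \<noteq> v" "x \<in> {1..d}" for u v x
      using lab that unfolding labeling_def bidirected_K_def by fastforce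
    define L where "L e = restrict (l e) {1..d}" for e
    define V where "V b = (\<lambda>a \<in> {1..d}. (L (b, a), L (a, b)))" for b
    define B where "B = {Suc d..n}"
    have LF: "L (u, v) \<in> F" if "u \<in> {1..n}" "v \<in> {1..n}" "u \<noteq> v" for u v
      unfolding F_def L_def using l[OF that] by (intro restrict_PiE_iff[THEN iffD2]) blast
    have VS: "V b \<in> S" if "b \<in> B" for b
      unfolding S_def V_def restrict_PiE_iff using that by (auto simp: B_def intro!: LF)
    have "\<exists>s \<in> S. d \<le> card {b \<in> B. V b = s}"
    proof (rule ccontr)
      assume "\<not> ?thesis"
      then have "(\<Sum>s\<in>S. card {b \<in> B. V b = s}) \<le> (\<Sum>s\<in>S. d)"
        by (intro sum_mono) (auto simp: not_le less_imp_le)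
      moreover have "(\<Union>s\<in>S. {b \<in> B. V b = s}) = B" using VS by auto
      then have "card B \<le> (\<Sum>s\<in>S. card {b \<in> B. V b = s})"
        using card_UN_le[OF finS, of "\<lambda>s. {b \<in> B. V b = s}"] by simp
      moreover have "card B = n - d" by (simp add: B_def)
      ultimately show False using large by simp
    qed
    then obtain s where s: "d \<le> card {b \<in> B. V b = s}" by blast
    then obtain C where C: "C \<subseteq> {b \<in> B. V b = s}" "card C = d" "finite C"
      by (meson obtain_subset_with_card_n)
    then obtain \<beta> where \<beta>: "bij_betw \<beta> {0..<d} C"
      using ex_bij_betw_nat_finite by blast
    have "\<beta> t \<in> C" if "t < d" for t
      using bij_betwE[OF \<beta>] that by simp
    then have \<beta>B: "\<beta> t \<in> B" "V (\<beta> t) = s" if "t < d" for t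
      using C(1) that by auto
    have same: "l (\<beta> t, a) x = l (\<beta> 0, a) x" "l (a, \<beta> t) x = l (a, \<beta> 0) x"
      if "t < d" "a \<in> {1..d}" "x \<in> {1..d}" for t a x
    proof -
      have "V (\<beta> t) a = V (\<beta> 0) a" using \<beta>B(2) that(1) assms by metis
      then have "L (\<beta> t, a) x = L (\<beta> 0, a) x" "L (a, \<beta> t) x = L (a, \<beta> 0) x"
        using that by (auto simp: V_def)
      then show "l (\<beta> t, a) x = l (\<beta> 0, a) x" "l (a, \<beta> t) x = l (a, \<beta> 0) x"
        using that by (auto simp: L_def)
    qed
    define x where "x = rec_nat 1 (\<lambda>t y. l (Suc t, \<beta> 0) (l (\<beta> 0, Suc t) y))"
    have x0: "x 0 = 1" and xS: "x (Suc t) = l (Suc t, \<beta> 0) (l (\<beta> 0, Suc t) (x t))" for t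
      by (simp_all add: x_def)
    have n: "d < n" using large by simp
    have \<beta>0: "d < \<beta> t" "\<beta> t \<le> n" if "t < d" for t
      using \<beta>B(1)[OF that] by (auto simp: B_def)
    have xd: "x t \<in> {1..d}" if "t \<le> d" for t
      using that
    proof (induction t)
      case 0
      then show ?case using assms by (simp add: x0)
    next
      case (Suc t)
      show ?case unfolding xS
        using Suc assms n \<beta>0[of 0] by (intro l) auto
    qed
    have "\<not> inj_on x {0..d}"
    proof
      assume "inj_on x {0..d}"
      moreover have "x ` {0..d} \<subseteq> {1..d}"
        using xd by (intro image_subsetI) simp
      ultimately have "card {0..d} \<le> card {1..d}"
        using card_inj_on_le[of x "{0..d}" "{1..d}"] by blast
      then show False by simp
    qed
    then obtain i j where ij: "i < j" "j \<le> d" "x i = x j"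
      unfolding inj_on_def by (metis atLeastAtMost_iff linorder_neqE_nat)
    define nx where "nx t = (if t = j then i else t)" for t
    define g where "g t = [(\<beta> (nx t), Suc t), (Suc t, \<beta> (nx (Suc t)))]" for t
    define p where "p = concat (map g [i..<j])"
    have nx: "nx t < d" if "t \<le> j" for t
      using that ij by (auto simp: nx_def)
    have ne: "p \<noteq> []" using ij by (auto simp: p_def g_def upt_conv_Cons)
    have arcs: "set p \<subseteq> parcs (bidirected_K n)"
    proof -
      have "set (g t) \<subseteq> parcs (bidirected_K n)" if "t \<in> {i..<j}" for t
        using that ij \<beta>0[OF nx[of t]] \<beta>0[OF nx[of "Suc t"]] n
        by (auto simp: g_def bidirected_K_def)
      then show ?thesis by (fastforce simp: p_def)
    qed
    have "pcas (\<beta> (nx i)) p (\<beta> (nx j))"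
      unfolding p_def using ij
      by (intro pcas_concat_upt[where y = "\<lambda>t. \<beta> (nx t)"]) (auto simp: g_def)
    moreover have "nx i = i" "nx j = i" using ij by (auto simp: nx_def)
    moreover have "fst (hd p) = \<beta> (nx i)" using ij by (simp add: p_def g_def upt_conv_Cons)
    ultimately have walk: "pcas (fst (hd p)) p (fst (hd p))" by simp
    have "distinct (concat (map (\<lambda>t. [Suc t, \<beta> (nx (Suc t))]) [i..<j]))"
    proof (rule distinct_concat_pairs)
      have "inj_on (\<lambda>t. nx (Suc t)) {i..<j}" by (auto simp: inj_on_def nx_def)
      moreover have "(\<lambda>t. nx (Suc t)) ` {i..<j} \<subseteq> {0..<d}" using nx by auto
      ultimately have "inj_on (\<beta> \<circ> (\<lambda>t. nx (Suc t))) {i..<j}"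
        using \<beta> by (intro comp_inj_on) (auto simp: bij_betw_def intro: inj_on_subset)
      then show "inj_on (\<lambda>t. \<beta> (nx (Suc t))) (set [i..<j])" by (simp add: o_def)
      have "Suc t < \<beta> (nx (Suc t'))" if "t < j" "t' < j" for t t'
        using that \<beta>0(1)[OF nx[of "Suc t'"]] ij by auto
      then show "Suc ` set [i..<j] \<inter> (\<lambda>t. \<beta> (nx (Suc t))) ` set [i..<j] = {}" by fastforce
    qed auto
    then have dist: "distinct (map snd p)"
      by (simp add: p_def g_def map_concat o_def)
    have "fold l p (x i) = x j"
      unfolding p_def
    proof (rule fold_concat_upt)
      fix t assume t: "t \<in> {i..<j}"
      then have td: "t < d" "x t \<in> {1..d}" using ij xd by auto
      have "l (\<beta> 0, Suc t) (x t) \<in> {1..d}"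
        using td n assms \<beta>0[of 0] by (intro l) auto
      then show "fold l (g t) (x t) = x (Suc t)"
        using same(1)[OF nx, of t "Suc t" "x t"] same(2)[OF nx, of "Suc t" "Suc t"] td t ij
        by (simp add: g_def xS)
    qed (use ij in simp)
    then have "fixed_point_cycle d n l p"
      using ne arcs walk dist ij xd[of i]
      by (auto simp: fixed_point_cycle_def cycle_bidirected_K_iff)
    then show False using free by (auto simp: fixed_point_free_def)
  qed
  then show ?thesis by blast
qed

lemma
  assumes "d > 0"
  shows R_f_attained: "R_f d \<ge> 1 \<and> has_fpf_labeling d (R_f d)"
    and R_f_upper: "n \<ge> 1 \<Longrightarrow> has_fpf_labeling d n \<Longrightarrow> n \<le> R_f d"
proof -
  obtain N where N: "\<forall>n. n \<ge> 1 \<and> has_fpf_labeling d n \<longrightarrow> n \<le> N"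
    using has_fpf_labeling_bounded[OF assms] by blast
  show "R_f d \<ge> 1 \<and> has_fpf_labeling d (R_f d)"
    unfolding R_f_def by (rule GreatestI_nat[of _ 1 N]) (use N has_fpf_labeling_1 in auto)
  show "n \<ge> 1 \<Longrightarrow> has_fpf_labeling d n \<Longrightarrow> n \<le> R_f d"
    unfolding R_f_def by (rule Greatest_le_nat[of _ n N]) (use N in auto)
qed

end

(* Assign to every vertex v an element c v of {1..d} uniformly at random, and call u a dead end if no
   v other than u satisfies c v = l (u, v) (c u). A given vertex is a dead end with probability
   (1 - 1/d)^(n - 1), so if n (1 - 1/d)^(n - 1) < 1 then some c has no dead ends. Following
   edges (u, v) with c v = l (u, v) (c u) then eventually closes a cycle that fixes the value of c at
   its starting vertex. Hence a fixed-point-free labeling forces d^(n - 1) <= n (d - 1)^(n - 1),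
   and therefore n - 1 <= d ln n. *)

theory Submission
  imports Defs
begin

text \<open>By pigeonhole the orbit repeats; \<open>j\<close> is taken as the least index that
  repeats an earlier one. Minimality gives the injectivity below \<open>j\<close>, which later makes
  a closed walk a simple cycle.\<close>

lemma iterate_first_return:
  fixes s :: "'a \<Rightarrow> 'a"
  assumes "finite A" "a \<in> A" "s \<in> A \<rightarrow> A"
  obtains i j where "i < j" "(s ^^ i) a = (s ^^ j) a" "inj_on (\<lambda>t. (s ^^ t) a) {..<j}"
proof -
  let ?P = "\<lambda>j. \<exists>i<j. (s ^^ i) a = (s ^^ j) a"
  have "(s ^^ t) a \<in> A" for t
    using assms by (induction t) auto
  then have "finite (range (\<lambda>t. (s ^^ t) a))"
    by (meson assms(1) finite_subset image_subsetI)
  then have "\<not> inj (\<lambda>t. (s ^^ t) a)"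
    using finite_imageD infinite_UNIV_nat by blast
  then have "\<exists>j. ?P j"
    unfolding inj_def by (metis linorder_neqE_nat)
  then obtain j where j: "?P j" "\<And>k. k < j \<Longrightarrow> \<not> ?P k"
    using exists_least_iff[of ?P] by blast
  have "inj_on (\<lambda>t. (s ^^ t) a) {..<j}"
  proof (rule linorder_inj_onI)
    fix t t' assume "t < t'" "t' \<in> {..<j}"
    then show "(s ^^ t) a \<noteq> (s ^^ t') a"
      using j(2)[of t'] by blast
  qed auto
  with j(1) that show thesis by blast
qed

text \<open>Iterating a choice of successors from vertex 1 must return to a visited vertex. Each arc
  used sends the selected value at its tail to the one at its head, so going once around the cycle
  fixes \<open>c (y i)\<close>.\<close>

lemma fixed_point_cycle_of_selection:
  assumes "n \<ge> 1" and c: "c \<in> {1..n} \<rightarrow> {1..d}"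
    and succ: "\<And>u. u \<in> {1..n} \<Longrightarrow> \<exists>v \<in> {1..n}. v \<noteq> u \<and> l (u, v) (c u) = c v"
  shows "\<exists>p. fixed_point_cycle d n l p"
proof -
  obtain s where s: "\<And>u. u \<in> {1..n} \<Longrightarrow> s u \<in> {1..n} \<and> s u \<noteq> u \<and> l (u, s u) (c u) = c (s u)"
    using succ by metis
  define y where "y t = (s ^^ t) 1" for t
  obtain i j where ij: "i < j" "y i = y j" and inj: "inj_on y {..<j}"
    using iterate_first_return[of "{1..n}" 1 s] s \<open>n \<ge> 1\<close> unfolding y_def by auto
  have yS: "y (Suc t) = s (y t)" for t
    by (simp add: y_def)
  have yn: "y t \<in> {1..n}" for t
  proof (induction t)
    case 0
    then show ?case using \<open>n \<ge> 1\<close> by (simp add: y_def)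
  next
    case (Suc t)
    then show ?case using s yS by simp
  qed
  \<comment> \<open>Singleton blocks put \<open>p\<close> into the form required by
    \<open>pcas_concat_upt\<close> and \<open>fold_concat_upt\<close>.\<close>
  define g where "g t = [(y t, y (Suc t))]" for t
  define p where "p = concat (map g [i..<j])"
  have p: "p = map (\<lambda>t. (y t, y (Suc t))) [i..<j]"
    unfolding p_def g_def by (induction "[i..<j]") (simp_all add: concat_map_singleton)
  have ne: "p \<noteq> []" and hd: "fst (hd p) = y i"
    using ij by (auto simp: p upt_conv_Cons)
  have arcs: "set p \<subseteq> parcs (bidirected_K n)"
  proof -
    have "y t \<noteq> y (Suc t)" for t
      using s[OF yn[of t]] yS[of t] by simp
    then show ?thesis
      using yn by (auto simp: p bidirected_K_def)
  qed
  have "pcas (y i) p (y j)"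
    unfolding p_def using ij by (intro pcas_concat_upt) (auto simp: g_def)
  then have walk: "pcas (fst (hd p)) p (fst (hd p))"
    using hd ij by simp
  have "inj_on (\<lambda>t. y (Suc t)) {i..<j}"
  proof (rule linorder_inj_onI)
    fix t t' assume t: "t < t'" "t \<in> {i..<j}" "t' \<in> {i..<j}"
    show "y (Suc t) \<noteq> y (Suc t')"
    \<comment> \<open>The heads of the arcs are \<open>y (i + 1)\<close>, ..., \<open>y j\<close>,
      and the index \<open>j\<close> lies just outside the range of injectivity. There
      \<open>y j\<close> is replaced by \<open>y i\<close>, and \<open>Suc t\<close> differs from
      \<open>i\<close> because \<open>t\<close> is at least \<open>i\<close>.\<close>
    proof (cases "Suc t' = j")
      case True
      then show ?thesis
        using inj_onD[OF inj, of "Suc t" i] t ij by auto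
    next
      case False
      then show ?thesis
        using inj_onD[OF inj, of "Suc t" "Suc t'"] t by auto
    qed
  qed auto
  then have dist: "distinct (map snd p)"
    by (simp add: p distinct_map o_def)
  have "fold l p (c (y i)) = c (y j)"
    unfolding p_def
    by (rule fold_concat_upt[where x = "\<lambda>t. c (y t)"])
      (use ij s[OF yn] yS in \<open>auto simp: g_def\<close>)
  moreover have "c (y i) \<in> {1..d}"
    using c yn by blast
  ultimately have "fixed_point_cycle d n l p"
    using ne arcs walk dist ij
    by (auto simp: fixed_point_cycle_def cycle_bidirected_K_iff)
  then show ?thesis by blast
qed

text \<open>Once \<open>c u = x\<close> is fixed, every other vertex has to avoid exactly one value,
  which leaves \<open>d - 1\<close> choices at each of \<open>n - 1\<close> vertices. Summing over
  \<open>x\<close> gives the factor \<open>d\<close>.\<close>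

lemma card_dead_end_le:
  assumes lab: "labeling d n l" and u: "u \<in> {1..n}"
  shows "card {c \<in> {1..n} \<rightarrow>\<^sub>E {1..d}. \<forall>v \<in> {1..n}. v \<noteq> u \<longrightarrow> l (u, v) (c u) \<noteq> c v}
    \<le> d * (d - 1) ^ (n - 1)" (is "card ?B \<le> _")
proof -
  define E where
    "E x = (\<Pi>\<^sub>E v \<in> {1..n}. if v = u then {x} else {1..d} - {l (u, v) x})" for x
  have cardE: "card (E x) = (d - 1) ^ (n - 1)" if "x \<in> {1..d}" for x
  proof -
    \<comment> \<open>The excluded value must lie in \<open>{1..d}\<close>; otherwise its removal
      would not lower the cardinality.\<close>
    have "l (u, v) x \<in> {1..d}" if "v \<in> {1..n}" "v \<noteq> u" for v
      using lab u that \<open>x \<in> {1..d}\<close> unfolding labeling_def bidirected_K_def by fastforce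
    then have "card (if v = u then {x} else {1..d} - {l (u, v) x}) = (if v = u then 1 else d - 1)"
      if "v \<in> {1..n}" for v
      using that by simp
    then have "card (E x) = (\<Prod>v \<in> {1..n}. if v = u then 1 else d - 1)"
      unfolding E_def by (subst card_PiE) (auto intro!: prod.cong)
    also have "\<dots> = (\<Prod>v \<in> {1..n} - {u}. d - 1)"
      using u by (subst prod.remove[of _ u]) (auto intro!: prod.cong)
    also have "\<dots> = (d - 1) ^ (n - 1)"
      using u by simp
    finally show ?thesis .
  qed
  have "?B \<subseteq> (\<Union>x \<in> {1..d}. E x)"
  proof
    fix c assume c: "c \<in> ?B"
    then have "c u \<in> {1..d}" using u by (auto simp: PiE_iff)
    moreover have "c \<in> E (c u)"
      using c by (auto simp: E_def PiE_iff)
    ultimately show "c \<in> (\<Union>x \<in> {1..d}. E x)" by blast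
  qed
  moreover have "finite (E x)" for x
    unfolding E_def by (intro finite_PiE) auto
  ultimately have "card ?B \<le> card (\<Union>x \<in> {1..d}. E x)"
    by (intro card_mono) auto
  also have "\<dots> \<le> (\<Sum>x \<in> {1..d}. card (E x))"
    by (rule card_UN_le) simp
  also have "\<dots> = d * (d - 1) ^ (n - 1)"
    using cardE by simp
  finally show ?thesis .
qed

text \<open>This is the union bound in counting form: every assignment has a dead end, so the
  \<open>n\<close> dead-end sets cover all \<open>d ^ n\<close> assignments. One factor
  \<open>d\<close> cancels.\<close>

lemma has_fpf_labeling_power_le:
  assumes "has_fpf_labeling d n" "n \<ge> 1" "d > 0"
  shows "d ^ (n - 1) \<le> n * (d - 1) ^ (n - 1)"
proof -
  obtain l where lab: "labeling d n l" and free: "fixed_point_free d n l"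
    using assms(1) by (auto simp: has_fpf_labeling_def)
  let ?\<Omega> = "{1..n} \<rightarrow>\<^sub>E {1..d}"
  let ?B = "\<lambda>u. {c \<in> ?\<Omega>. \<forall>v \<in> {1..n}. v \<noteq> u \<longrightarrow> l (u, v) (c u) \<noteq> c v}"
  have fin: "finite ?\<Omega>"
    by (intro finite_PiE) auto
  have "?\<Omega> \<subseteq> (\<Union>u \<in> {1..n}. ?B u)"
  proof
    fix c assume c: "c \<in> ?\<Omega>"
    then have "c \<in> {1..n} \<rightarrow> {1..d}"
      by blast
    then have "\<exists>u \<in> {1..n}. \<forall>v \<in> {1..n}. v \<noteq> u \<longrightarrow> l (u, v) (c u) \<noteq> c v"
      using fixed_point_cycle_of_selection[OF \<open>n \<ge> 1\<close>, of c d l] free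
      unfolding fixed_point_free_def by blast
    with c show "c \<in> (\<Union>u \<in> {1..n}. ?B u)" by blast
  qed
  then have "card ?\<Omega> \<le> card (\<Union>u \<in> {1..n}. ?B u)"
    using fin by (intro card_mono) auto
  also have "\<dots> \<le> (\<Sum>u \<in> {1..n}. card (?B u))"
    by (rule card_UN_le) simp
  also have "\<dots> \<le> (\<Sum>u \<in> {1..n}. d * (d - 1) ^ (n - 1))"
    by (intro sum_mono card_dead_end_le[OF lab])
  finally have "d ^ n \<le> n * (d * (d - 1) ^ (n - 1))"
    by (simp add: card_PiE)
  moreover have "d ^ n = d * d ^ (n - 1)"
    using \<open>n \<ge> 1\<close> by (cases n) auto
  ultimately show ?thesis
    using \<open>d > 0\<close> by simp
qed

text \<open>Dividing by \<open>d ^ (n - 1)\<close> and using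
  \<open>1 - 1/d \<le> exp (- 1/d)\<close> gives \<open>1 \<le> n * exp (- (n - 1)/d)\<close>; then
  take logarithms.\<close>

lemma le_of_power_le_mult_power_pred:
  assumes "d ^ (n - 1) \<le> n * (d - 1) ^ (n - 1)" "n \<ge> 1" "d > 0"
  shows "real n - 1 \<le> real d * ln (real n)"
proof -
  have "real d ^ (n - 1) \<le> real n * (real d - 1) ^ (n - 1)"
    using of_nat_mono[OF assms(1), where 'a = real] \<open>d > 0\<close> by (simp add: of_nat_diff)
  also have "real d - 1 = real d * (1 - 1 / real d)"
    using \<open>d > 0\<close> by (simp add: field_simps)
  finally have "1 \<le> real n * (1 - 1 / real d) ^ (n - 1)"
    using \<open>d > 0\<close> by (simp add: power_mult_distrib)
  also have "\<dots> \<le> real n * exp (- (1 / real d)) ^ (n - 1)"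
    using \<open>d > 0\<close> exp_ge_add_one_self[of "- (1 / real d)"]
    by (intro mult_left_mono power_mono) (auto simp: field_simps)
  also have "\<dots> = real n * exp (- ((real n - 1) / real d))"
    using \<open>n \<ge> 1\<close> by (simp flip: exp_of_nat_mult add: of_nat_diff)
  finally have "0 \<le> ln (real n * exp (- ((real n - 1) / real d)))"
    by simp
  also have "\<dots> = ln (real n) - (real n - 1) / real d"
    using \<open>n \<ge> 1\<close> by (subst ln_mult) auto
  finally show ?thesis
    using \<open>d > 0\<close> by (simp add: field_simps)
qed

text \<open>A crude quadratic bound is enough for the exponent \<open>2 + o(1)\<close>. With
  \<open>r = sqrt x\<close>, the estimate \<open>ln x = 2 * ln r \<le> 2 * (r - 1)\<close> lets the
  factor \<open>r - 1\<close> of \<open>x - 1\<close> cancel.\<close>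

lemma le_square_of_le_mult_ln:
  fixes x d :: real
  assumes "x - 1 \<le> d * ln x" "x \<ge> 1" "d \<ge> 1"
  shows "x \<le> 4 * d\<^sup>2"
proof -
  define r where "r = sqrt x"
  have r: "x = r\<^sup>2" "r \<ge> 1"
    using assms by (auto simp: r_def)
  have "ln x = 2 * ln r"
    using r by (simp add: ln_realpow)
  also have "\<dots> \<le> 2 * (r - 1)"
    using ln_le_minus_one[of r] r by simp
  finally have "d * ln x \<le> d * (2 * (r - 1))"
    using assms by (intro mult_left_mono) auto
  then have "(r - 1) * (r + 1) \<le> (r - 1) * (2 * d)"
    using assms(1) r by (simp add: power2_eq_square algebra_simps)
  \<comment> \<open>For \<open>r = 1\<close> nothing can be cancelled, and the bound comes from
    \<open>d \<ge> 1\<close> instead.\<close>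
  then have "r \<le> 2 * d"
    using r assms(3) by (cases "r = 1") auto
  then have "r\<^sup>2 \<le> (2 * d)\<^sup>2"
    using r by (intro power_mono) auto
  then show ?thesis
    using r by simp
qed

text \<open>The witness \<open>ln 4 / ln (real d)\<close> solves
  \<open>d powr \<epsilon> = 4\<close> for \<open>d \<ge> 2\<close>. It therefore absorbs the
  constant in \<open>4 * d^2\<close>, and it vanishes in the limit because \<open>ln d\<close> is
  unbounded.\<close>

theorem theorem2:
  shows "\<exists>\<epsilon> :: nat \<Rightarrow> real.
    \<epsilon> \<longlonglongrightarrow> 0 \<and> (\<forall>d::nat. d > 0 \<longrightarrow> real (R_f d) \<le> real d powr (2 + \<epsilon> d))"
proof (intro exI[of _ "\<lambda>d. ln 4 / ln (real d)"] conjI allI impI)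
  show "(\<lambda>d. ln 4 / ln (real d)) \<longlonglongrightarrow> (0 :: real)"
    by (intro tendsto_divide_0[OF tendsto_const] filterlim_at_top_imp_at_infinity
        filterlim_compose[OF ln_at_top filterlim_real_sequentially])
next
  fix d :: nat assume d: "d > 0"
  define n where "n = R_f d"
  have n: "n \<ge> 1" "d ^ (n - 1) \<le> n * (d - 1) ^ (n - 1)"
    using R_f_attained[OF d] has_fpf_labeling_power_le[of d n] d by (auto simp: n_def)
  have "real n \<le> real d powr (2 + ln 4 / ln (real d))"
  proof (cases "d = 1")
    case True
    \<comment> \<open>If \<open>n \<ge> 2\<close>, the power of \<open>d - 1 = 0\<close> would
      vanish and the inequality would read \<open>1 \<le> 0\<close>. The right-hand side of the goal
      is 1 here, as a power of 1 with any exponent.\<close>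
    then have "n = 1"
      using n by (cases "n - 1") auto
    then show ?thesis using True by simp
  next
    case False
    have "real n \<le> 4 * (real d)\<^sup>2"
      using le_of_power_le_mult_power_pred[OF n(2,1) d] n d by (intro le_square_of_le_mult_ln) auto
    also have "4 = real d powr (ln 4 / ln (real d))"
      using d False by (simp add: powr_def)
    also have "\<dots> * (real d)\<^sup>2 = real d powr (2 + ln 4 / ln (real d))"
      using d by (simp add: powr_add)
    finally show ?thesis .
  qed
  then show "real (R_f d) \<le> real d powr (2 + ln 4 / ln (real d))"
    by (simp add: n_def)
qed

end
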